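(* Let $\xi=(\xi_t,t\ge 0)$ be a real-valued Lévy process, let $q>0$, let $\mathbf{e}_q$ be an exponential random variable with parameter $q$ independent of $\xi$, and let $I_{\mathbf{e}_q}:=\int_0^{\mathbf{e}_q}e^{\xi_s}\,\mathrm{d}s$. Let $X$ under $\mathbb{Q}_1$ be the positive self-similar Markov process with index $1$, issued from $1$, associated via Lamperti's representation to $\xi$ killed at rate $q$, and let $T_0$ be its first hitting time of $0$. Then the function $$h(t):=q\,\mathbb{Q}_{1}\left[\frac{1}{X_{t}}\mathbf{1}_{\{t<T_{0}\}}\right],\qquad t\geq 0,$$ is a density for the law of $I_{\mathbf{e}_q}$.
   Context: A real-valued Lévy process is issued from the origin, has stationary independent increments and almost surely right-continuous paths with left limits. Let $\xi^\dag$ be the process obtained by killing $\xi$ at the independent exponential time $\mathbf{e}_q$; its lifetime is denoted by $\beta$ (which has the law of $\mathbf{e}_q$), and $e^{\xi^\dag_t}$ is taken to be $0$ for $t\ge\beta$. For $s\ge 0$ set $$\tau(s)=\inf\Big\{r>0:\int_0^r e^{\xi^\dag_t}\,\mathrm{d}t>s\Big\},\qquad \inf\emptyset=\infty.$$ For $x>0$ define $$X^{(x)}_t=x\exp\{\xi^\dag_{\tau(t/x)}\}\ \text{ if }\tau(t/x)<\infty,\qquad X^{(x)}_t=0\ \text{ if }\tau(t/x)=\infty,\qquad t\ge 0,$$ where $0$ is a cemetery state. $\mathbb{Q}_x$ denotes the law of $X^{(x)}$ (and also the corresponding expectation), $X$ the canonical process, and $T_0=\inf\{t>0:X_t=0\}$.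 *)

theory Defs
  imports "HOL-Probability.Probability"
begin

definition cadlag :: "(real \<Rightarrow> real) \<Rightarrow> bool" where
  "cadlag f \<longleftrightarrow>
     (\<forall>t\<ge>0. continuous (at_right t) f) \<and>
     (\<forall>t>0. \<exists>l. (f \<longlongrightarrow> l) (at_left t))"

text \<open>Processes are functions of a real time of which only the values at times \<open>t \<ge> 0\<close> are
  constrained or used.\<close>

definition levy_process :: "'a measure \<Rightarrow> (real \<Rightarrow> 'a \<Rightarrow> real) \<Rightarrow> bool" where
  "levy_process M \<xi> \<longleftrightarrow>
     (\<forall>t\<ge>0. \<xi> t \<in> borel_measurable M) \<and>
     (AE \<omega> in M. \<xi> 0 \<omega> = 0) \<and>
     (\<forall>s\<ge>0. \<forall>t\<ge>0.
        distr M borel (\<lambda>\<omega>. \<xi> (s + t) \<omega> - \<xi> s \<omega>) = distr M borel (\<xi> t)) \<and>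
     (\<forall>(n::nat) (u::nat \<Rightarrow> real). 0 \<le> u 0 \<and> (\<forall>i<n. u i < u (Suc i)) \<longrightarrow>
        prob_space.indep_vars M (\<lambda>_. borel)
          (\<lambda>i \<omega>. \<xi> (u (Suc i)) \<omega> - \<xi> (u i) \<omega>) {..<n}) \<and>
     (AE \<omega> in M. cadlag (\<lambda>t. \<xi> t \<omega>))"

text \<open>Independence of the sigma-algebras generated by \<open>e\<close> and by the whole process.
  (The library's \<open>indep_var\<close> needs both variables to have the same value type.)\<close>

definition indep_of_process :: "'a measure \<Rightarrow> ('a \<Rightarrow> real) \<Rightarrow> (real \<Rightarrow> 'a \<Rightarrow> real) \<Rightarrow> bool" where
  "indep_of_process M e \<xi> \<longleftrightarrow>
     prob_space.indep_set M
       (sets (vimage_algebra (space M) e borel))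
       (sets (vimage_algebra (space M) (\<lambda>\<omega>. \<lambda>t\<in>{0..}. \<xi> t \<omega>) (\<Pi>\<^sub>M t\<in>{0..}. borel)))"

text \<open>The integrals below are Bochner integrals; along cadlag paths the integrands are
  bounded on compact intervals, so almost surely no default value is involved.\<close>

definition exp_functional :: "(real \<Rightarrow> 'a \<Rightarrow> real) \<Rightarrow> ('a \<Rightarrow> real) \<Rightarrow> 'a \<Rightarrow> real" where
  "exp_functional \<xi> e \<omega> = (LBINT s:{0..e \<omega>}. exp (\<xi> s \<omega>))"

text \<open>The exponential of the process killed at time \<open>e\<close>, equal to 0 after killing.\<close>

definition exp_killed :: "(real \<Rightarrow> 'a \<Rightarrow> real) \<Rightarrow> ('a \<Rightarrow> real) \<Rightarrow> real \<Rightarrow> 'a \<Rightarrow> real" where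
  "exp_killed \<xi> e t \<omega> = (if t < e \<omega> then exp (\<xi> t \<omega>) else 0)"

definition time_change :: "(real \<Rightarrow> 'a \<Rightarrow> real) \<Rightarrow> ('a \<Rightarrow> real) \<Rightarrow> real \<Rightarrow> 'a \<Rightarrow> ereal" where
  "time_change \<xi> e s \<omega> = Inf (ereal ` {r. r > 0 \<and> (LBINT t:{0..r}. exp_killed \<xi> e t \<omega>) > s})"

definition lamperti ::
  "(real \<Rightarrow> 'a \<Rightarrow> real) \<Rightarrow> ('a \<Rightarrow> real) \<Rightarrow> real \<Rightarrow> real \<Rightarrow> 'a \<Rightarrow> real" where
  "lamperti \<xi> e x t \<omega> =
     (if time_change \<xi> e (t / x) \<omega> < \<infinity>
      then x * exp_killed \<xi> e (real_of_ereal (time_change \<xi> e (t / x) \<omega>)) \<omega>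
      else 0)"

text \<open>The canonical space: cadlag paths in \<open>[0, \<infinity>)\<close> absorbed at the cemetery state 0, with
  the sigma-algebra generated by the coordinate maps. On the space of all paths the hitting
  time of 0 would not be measurable.\<close>

definition path_space :: "(real \<Rightarrow> real) measure" where
  "path_space = restrict_space (\<Pi>\<^sub>M t\<in>{0..}. borel)
     {w. cadlag w \<and> (\<forall>t\<ge>0. 0 \<le> w t) \<and> (\<forall>s\<ge>0. \<forall>t\<ge>s. w s = 0 \<longrightarrow> w t = 0)}"

text \<open>The law of the Lamperti process started from \<open>x\<close>. Since its paths lie in the canonical space
  only almost surely, and since the basic probability space need not be complete, the
  image is taken under the completed measure: the preimage of every set of \<open>path_space\<close>
  is then measurable.\<close>

definition pssmp_law ::
  "'a measure \<Rightarrow> (real \<Rightarrow> 'a \<Rightarrow> real) \<Rightarrow> ('a \<Rightarrow> real) \<Rightarrow> real \<Rightarrow> (real \<Rightarrow> real) measure" where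
  "pssmp_law M \<xi> e x =
     distr (completion M) path_space (\<lambda>\<omega>. \<lambda>t\<in>{0..}. lamperti \<xi> e x t \<omega>)"

definition hit_zero :: "(real \<Rightarrow> real) \<Rightarrow> ereal" where
  "hit_zero w = Inf (ereal ` {t. t > 0 \<and> w t = 0})"

end

theory Submission
  imports Defs
begin

text \<open>Write \<open>A s\<close> for the integral of \<open>exp \<xi>\<close> over \<open>[0, s]\<close>. The exponential functional is \<open>A\<close> taken at the
independent exponential time \<open>e\<close>, and the Lamperti process started from 1 is \<open>X\<close> with
\<open>X (A s) = exp (\<xi> s)\<close> for \<open>s < e\<close>, absorbed at 0 from the time \<open>A e\<close> on. For a test function \<open>f \<ge> 0\<close>,
the integral of \<open>f h\<close> is \<open>q\<close> times the mean of the integral of \<open>f t / X t\<close> over \<open>t < A e\<close>.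

Along each path substitute \<open>t = A s\<close>. The Jacobian \<open>exp (\<xi> s)\<close> cancels \<open>1 / X t\<close>, and what remains is the
integral of \<open>f (A s)\<close> over \<open>0 \<le> s < e\<close> (\<open>nn_integral_inverse_lamperti\<close>, resting on \<open>distr_clock\<close>).
Now take means. By independence, each \<open>s\<close> contributes the mean of \<open>f (A s)\<close> weighted with
\<open>q P(e > s) = q exp (- q s)\<close>, which is the density of \<open>e\<close> at \<open>s\<close>. So the total is the mean of \<open>f (A e)\<close>
(\<open>nn_integral_exponential_horizon\<close>), which says that \<open>h\<close> is a density of \<open>A e\<close>.

The rest is measurability. Exchanging integrals over time and probability space requires joint
measurability, while the paths are cadlag only almost surely. Therefore \<open>A\<close> and \<open>X\<close> are given versions
\<open>right_clock\<close> and \<open>right_lamperti\<close> that are defined from countably many coordinates of an arbitrary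
path and agree with \<open>A\<close> and \<open>X\<close> on cadlag ones. Almost every Lamperti path is shown to be cadlag
and absorbed at 0 (\<open>lamperti_in_path_space\<close>), so that the law of \<open>X\<close> is the image of a measurable
modification (\<open>distr_completion_AE\<close>, \<open>nn_integral_pssmp_law\<close>).\<close>

section \<open>Cadlag paths\<close>

text \<open>For \<open>t \<ge> 0\<close>, the first point of the grid of mesh \<open>1 / (n + 1)\<close> that lies strictly to the right of \<open>t\<close>.\<close>

definition grid :: "nat \<Rightarrow> real \<Rightarrow> real" where
  "grid n t = (real (nat \<lfloor>real (Suc n) * t\<rfloor>) + 1) / real (Suc n)"

text \<open>For a cadlag path this is just \<open>exp (f t)\<close>, by right continuity. It is written as a limit over
countably many values of \<open>f\<close> so that it remains measurable in time and path jointly, for every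
path: no null set has to be removed and the sub-sigma-algebra generated by the process suffices.\<close>

definition right_exp :: "(real \<Rightarrow> real) \<Rightarrow> real \<Rightarrow> ennreal" where
  "right_exp f t = liminf (\<lambda>n. ennreal (exp (f (grid n t))))"

lemma grid_bounds:
  assumes "0 \<le> t"
  shows "t < grid n t" "grid n t \<le> t + 1 / real (Suc n)"
proof -
  have *: "real (nat \<lfloor>real (Suc n) * t\<rfloor>) = of_int \<lfloor>real (Suc n) * t\<rfloor>"
    using assms by simp
  have "real (Suc n) * t < of_int \<lfloor>real (Suc n) * t\<rfloor> + 1"
    by linarith
  then show "t < grid n t"
    unfolding grid_def * by (simp add: field_simps)
  have "(of_int \<lfloor>real (Suc n) * t\<rfloor> + 1) / real (Suc n) \<le> (real (Suc n) * t + 1) / real (Suc n)"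
    by (intro divide_right_mono) auto
  also have "\<dots> = t + 1 / real (Suc n)"
    by (simp add: add_divide_distrib)
  finally show "grid n t \<le> t + 1 / real (Suc n)"
    unfolding grid_def * .
qed

lemma grid_tendsto:
  assumes "0 \<le> t"
  shows "filterlim (\<lambda>n. grid n t) (at_right t) sequentially"
proof -
  have "(\<lambda>n. grid n t) \<longlonglongrightarrow> t"
  proof (rule tendsto_sandwich[where f="\<lambda>_. t"])
    show "(\<lambda>n. t + 1 / real (Suc n)) \<longlonglongrightarrow> t"
      using tendsto_add[OF tendsto_const LIMSEQ_inverse_real_of_nat, of t]
      by (simp add: inverse_eq_divide)
    show "\<forall>\<^sub>F n in sequentially. t \<le> grid n t"
      using grid_bounds(1)[OF assms] by (simp add: less_imp_le)
    show "\<forall>\<^sub>F n in sequentially. grid n t \<le> t + 1 / real (Suc n)"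
      using grid_bounds(2)[OF assms] by simp
  qed auto
  moreover have "\<forall>\<^sub>F n in sequentially. grid n t \<in> {t<..} \<and> grid n t \<noteq> t"
    using grid_bounds(1)[OF assms] by (intro always_eventually) (simp add: less_imp_neq[symmetric])
  ultimately show ?thesis
    unfolding filterlim_at by simp
qed

lemma right_exp_eq:
  assumes "cadlag f" "0 \<le> t"
  shows "right_exp f t = ennreal (exp (f t))"
proof -
  have "(f \<longlongrightarrow> f t) (at_right t)"
    using assms by (auto simp: cadlag_def continuous_within)
  then have "(\<lambda>n. f (grid n t)) \<longlonglongrightarrow> f t"
    by (rule filterlim_compose[OF _ grid_tendsto[OF assms(2)]])
  then have "(\<lambda>n. ennreal (exp (f (grid n t)))) \<longlonglongrightarrow> ennreal (exp (f t))"
    by (intro tendsto_intros)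
  then show ?thesis
    unfolding right_exp_def by (intro lim_imp_Liminf) auto
qed

lemma borel_measurable_right_exp_pair:
  assumes "\<And>t. 0 \<le> t \<Longrightarrow> \<xi> t \<in> borel_measurable N"
  shows "(\<lambda>p. right_exp (\<lambda>t. \<xi> t (snd p)) (fst p)) \<in> borel_measurable (borel \<Otimes>\<^sub>M N)"
proof -
  have "(\<lambda>p. \<xi> (grid n (fst p)) (snd p)) \<in> borel_measurable (borel \<Otimes>\<^sub>M N)" for n
    unfolding grid_def
  proof (rule measurable_compose_countable[
        where f="\<lambda>k p. \<xi> ((real k + 1) / real (Suc n)) (snd p)"
          and g="\<lambda>p. nat \<lfloor>real (Suc n) * fst p\<rfloor>"])
    fix k :: nat
    have [measurable]: "\<xi> ((real k + 1) / real (Suc n)) \<in> borel_measurable N"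
      by (intro assms) simp
    show "(\<lambda>p. \<xi> ((real k + 1) / real (Suc n)) (snd p)) \<in> borel_measurable (borel \<Otimes>\<^sub>M N)"
      by measurable
  qed measurable
  then show ?thesis
    unfolding right_exp_def by measurable
qed

text \<open>The case of a single path, seen as a process on a one-point space.\<close>

lemma borel_measurable_right_exp: "right_exp f \<in> borel_measurable borel"
proof -
  have "(\<lambda>p. right_exp (\<lambda>t. f t) (fst p)) \<in> borel_measurable (borel \<Otimes>\<^sub>M count_space (UNIV::unit set))"
    by (rule borel_measurable_right_exp_pair) auto
  then have "(\<lambda>t. right_exp f (fst (t, ()))) \<in> borel_measurable borel"
    by (rule measurable_compose[rotated]) measurable
  then show ?thesis by simp
qed

text \<open>One-sided limits bound the path on either side of each point of the compact interval, and the
Bolzano principle patches the local bounds together. At the left end point only the right limit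
exists, which is why the patched property concerns nonnegative times.\<close>

lemma cadlag_bounded:
  assumes f: "cadlag f" and "0 \<le> s"
  shows "\<exists>B. \<forall>t\<in>{0..s}. \<bar>f t\<bar> \<le> B"
proof -
  define P where "P a b \<longleftrightarrow> (\<exists>B. \<forall>t\<in>{a..b} \<inter> {0..}. \<bar>f t\<bar> \<le> B)" for a b :: real
  have "P 0 s"
    using \<open>0 \<le> s\<close>
  proof (induction rule: Bolzano)
    case (trans a b c)
    then obtain B B' where B: "\<And>t. t \<in> {a..b} \<inter> {0..} \<Longrightarrow> \<bar>f t\<bar> \<le> B"
        "\<And>t. t \<in> {b..c} \<inter> {0..} \<Longrightarrow> \<bar>f t\<bar> \<le> B'"
      unfolding P_def by blast
    have "\<bar>f t\<bar> \<le> max B B'" if "t \<in> {a..c} \<inter> {0..}" for t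
      using B[of t] that by (cases "t \<le> b") (simp_all add: le_max_iff_disj)
    then show ?case unfolding P_def by blast
  next
    case (local x)
    have near: "\<exists>B. eventually (\<lambda>y. \<bar>f y\<bar> \<le> B) F" if "(f \<longlongrightarrow> l) F" for l F
    proof -
      have "eventually (\<lambda>y. dist (f y) l < 1) F"
        using that by (rule tendstoD) simp
      then have "eventually (\<lambda>y. \<bar>f y\<bar> \<le> \<bar>l\<bar> + 1) F"
        by eventually_elim (auto simp: dist_real_def)
      then show ?thesis by blast
    qed
    have "(f \<longlongrightarrow> f x) (at_right x)"
      using f local by (auto simp: cadlag_def continuous_within)
    from near[OF this] obtain B1 d1 where B1: "x < d1" "\<And>y. x < y \<Longrightarrow> y < d1 \<Longrightarrow> \<bar>f y\<bar> \<le> B1"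
      unfolding eventually_at_right_field by blast
    have "\<exists>B2 d2. d2 < x \<and> (\<forall>y. d2 < y \<longrightarrow> y < x \<longrightarrow> 0 \<le> y \<longrightarrow> \<bar>f y\<bar> \<le> B2)"
    proof (cases "x = 0")
      case True
      then show ?thesis by (intro exI[of _ 0] exI[of _ "-1"]) auto
    next
      case False
      then obtain l where "(f \<longlongrightarrow> l) (at_left x)"
        using f local unfolding cadlag_def by (metis less_eq_real_def)
      from near[OF this] show ?thesis
        unfolding eventually_at_left_field by blast
    qed
    then obtain B2 d2 where B2: "d2 < x" "\<And>y. d2 < y \<Longrightarrow> y < x \<Longrightarrow> 0 \<le> y \<Longrightarrow> \<bar>f y\<bar> \<le> B2"
      by blast
    let ?d = "min (d1 - x) (x - d2)"
    have "P a b" if "a \<le> x" "x \<le> b" "b - a < ?d" for a b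
    proof -
      have "\<bar>f t\<bar> \<le> max \<bar>f x\<bar> (max B1 B2)" if t: "t \<in> {a..b} \<inter> {0..}" for t
      proof (cases t x rule: linorder_cases)
        case less
        then show ?thesis
          using t B2(2)[of t] \<open>a \<le> x\<close> \<open>x \<le> b\<close> \<open>b - a < ?d\<close>
          by (simp add: le_max_iff_disj)
      next
        case greater
        then show ?thesis
          using t B1(2)[of t] \<open>a \<le> x\<close> \<open>x \<le> b\<close> \<open>b - a < ?d\<close>
          by (simp add: le_max_iff_disj)
      qed simp
      then show ?thesis unfolding P_def by blast
    qed
    moreover have "0 < ?d" using B1(1) B2(1) by auto
    ultimately show ?case by blast
  qed
  then show ?thesis by (auto simp: P_def)
qed

section \<open>The additive functional of a cadlag path\<close>

definition clock :: "(real \<Rightarrow> real) \<Rightarrow> real \<Rightarrow> real" where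
  "clock f s = (LBINT t:{0..s}. exp (f t))"

text \<open>The same functional as \<open>clock\<close> on cadlag paths, but built on \<open>right_exp\<close> and hence jointly
measurable in time and path.\<close>

definition right_clock :: "(real \<Rightarrow> real) \<Rightarrow> real \<Rightarrow> real" where
  "right_clock f s = enn2real (\<integral>\<^sup>+ t. right_exp f t * indicator {0..s} t \<partial>lborel)"

locale cadlag_path =
  fixes f :: "real \<Rightarrow> real"
  assumes cadlag: "cadlag f"
begin

lemma borel_measurable_exp_path:
  "(\<lambda>t. if 0 \<le> t then exp (f t) else 0) \<in> borel_measurable borel"
proof -
  have [measurable]: "right_exp f \<in> borel_measurable borel"
    by (rule borel_measurable_right_exp)
  have "(\<lambda>t. if 0 \<le> t then exp (f t) else 0) = (\<lambda>t. if 0 \<le> t then enn2real (right_exp f t) else 0)"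
    using right_exp_eq[OF cadlag] by auto
  also have "\<dots> \<in> borel_measurable borel"
    by measurable
  finally show ?thesis .
qed

lemma exp_integrable: "0 \<le> a \<Longrightarrow> set_integrable lborel {a..b} (\<lambda>t. exp (f t))"
proof (cases "a \<le> b")
  case True
  assume "0 \<le> a"
  note [measurable] = borel_measurable_exp_path
  obtain B where B: "\<forall>t\<in>{0..b}. \<bar>f t\<bar> \<le> B"
    using cadlag_bounded[OF cadlag, of b] \<open>0 \<le> a\<close> True by auto
  have "integrable lborel (\<lambda>t. indicator {a..b} t *\<^sub>R (if 0 \<le> t then exp (f t) else 0))"
    using B \<open>0 \<le> a\<close>
    by (intro integrableI_bounded_set_indicator[where B="exp B"])
       (auto simp: abs_le_iff emeasure_lborel_Icc_eq)
  also have "(\<lambda>t. indicator {a..b} t *\<^sub>R (if 0 \<le> t then exp (f t) else 0))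
      = (\<lambda>t. indicator {a..b} t *\<^sub>R exp (f t))"
    using \<open>0 \<le> a\<close> by (auto simp: indicator_def)
  finally show ?thesis unfolding set_integrable_def .
qed (simp add: set_integrable_def)

lemma clock_eq_integral: "clock f s = integral {0..s} (\<lambda>t. exp (f t))"
  unfolding clock_def by (intro set_borel_integral_eq_integral exp_integrable) simp

lemma clock_nonpos [simp]: "s \<le> 0 \<Longrightarrow> clock f s = 0"
  unfolding clock_eq_integral by (cases "s = 0") auto

lemma clock_add:
  assumes "0 \<le> r" "r \<le> s"
  shows "clock f s = clock f r + integral {r..s} (\<lambda>t. exp (f t))"
  unfolding clock_eq_integral
  using assms set_borel_integral_eq_integral(1)[OF exp_integrable[of 0 s]]
  by (intro Henstock_Kurzweil_Integration.integral_combine[symmetric]) auto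

lemma clock_less:
  assumes "0 \<le> r" "r < s"
  shows "clock f r < clock f s"
proof -
  obtain B where B: "\<And>t. t \<in> {0..s} \<Longrightarrow> \<bar>f t\<bar> \<le> B"
    using cadlag_bounded[OF cadlag, of s] assms by fastforce
  have "integral {r..s} (\<lambda>t. exp (- B)) \<le> integral {r..s} (\<lambda>t. exp (f t))"
  proof (rule integral_le)
    show "(\<lambda>t. exp (f t)) integrable_on {r..s}"
      using assms by (intro set_borel_integral_eq_integral(1) exp_integrable)
    fix t assume "t \<in> {r..s}"
    then show "exp (- B) \<le> exp (f t)"
      using B[of t] assms by simp
  qed (simp add: integrable_const_ivl)
  moreover have "0 < integral {r..s} (\<lambda>t. exp (- B))"
    using assms by simp
  ultimately show ?thesis
    using clock_add[of r s] assms by linarith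
qed

lemma clock_less_iff: "0 \<le> r \<Longrightarrow> 0 \<le> s \<Longrightarrow> clock f r < clock f s \<longleftrightarrow> r < s"
  using clock_less[of r s] clock_less[of s r] by (cases r s rule: linorder_cases) auto

lemma clock_le_iff: "0 \<le> r \<Longrightarrow> 0 \<le> s \<Longrightarrow> clock f r \<le> clock f s \<longleftrightarrow> r \<le> s"
  using clock_less_iff[of s r] by auto

lemma mono_clock: "mono (clock f)"
proof (rule monoI)
  fix r s :: real assume "r \<le> s"
  then show "clock f r \<le> clock f s"
    using clock_less[of r s] clock_less[of 0 s]
    by (cases "r \<le> 0"; cases "s \<le> 0"; cases "r = s") simp_all
qed

lemma clock_nonneg: "0 \<le> clock f s"
  using monoD[OF mono_clock, of "min 0 s" s] by simp

lemma continuous_on_clock: "continuous_on {0..s} (clock f)"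
  unfolding clock_eq_integral
  by (intro indefinite_integral_continuous_1 set_borel_integral_eq_integral(1) exp_integrable) simp

text \<open>The clock runs continuously and strictly upwards from 0, so that its range over a lifetime is the
interval whose length is the exponential functional.\<close>

lemma clock_surj:
  assumes "0 \<le> b" "0 \<le> t" "t \<le> clock f b"
  obtains s where "0 \<le> s" "s \<le> b" "clock f s = t"
  using IVT'[of "clock f" 0 t b] assms continuous_on_clock by auto

lemma nn_integral_right_exp:
  assumes "0 \<le> a"
  shows "(\<integral>\<^sup>+ t. right_exp f t * indicator {a..b} t \<partial>lborel) = ennreal (integral {a..b} (\<lambda>t. exp (f t)))"
proof -
  have "(\<integral>\<^sup>+ t. right_exp f t * indicator {a..b} t \<partial>lborel)
      = (\<integral>\<^sup>+ t. ennreal (indicator {a..b} t *\<^sub>R exp (f t)) \<partial>lborel)"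
    using assms by (intro nn_integral_cong) (auto simp: right_exp_eq[OF cadlag] indicator_def)
  also have "\<dots> = ennreal (LBINT t:{a..b}. exp (f t))"
    unfolding set_lebesgue_integral_def
    by (intro nn_integral_eq_integral) (use exp_integrable assms in \<open>auto simp: set_integrable_def\<close>)
  also have "\<dots> = ennreal (integral {a..b} (\<lambda>t. exp (f t)))"
    using set_borel_integral_eq_integral(2)[OF exp_integrable[OF assms]] by simp
  finally show ?thesis .
qed

lemma clock_eq_nn_integral:
  "clock f s = enn2real (\<integral>\<^sup>+ t. right_exp f t * indicator {0..s} t \<partial>lborel)"
  using nn_integral_right_exp[of 0 s] clock_nonneg[of s] by (simp add: clock_eq_integral)

text \<open>The substitution \<open>t = clock f s\<close>, \<open>dt = exp (f s) ds\<close>. Since \<open>f\<close> may jump, the clock need not be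
differentiable; instead of a substitution rule, the masses of half-lines are compared. The half-line
above \<open>x \<ge> 0\<close> is pulled back to the times after the moment \<open>r\<close> at which the clock shows \<open>x\<close>, and there
\<open>exp f\<close> integrates to the increment of the clock from \<open>x\<close> on.\<close>

lemma distr_clock:
  assumes "0 < b"
  shows "distr (density lborel (\<lambda>s. right_exp f s * indicator {0..<b} s)) borel (clock f)
    = density lborel (indicator {0..<clock f b})" (is "?D = ?U")
proof (rule measure_eqI_lessThan)
  have [measurable]: "right_exp f \<in> borel_measurable borel" "clock f \<in> borel_measurable borel"
    using borel_measurable_right_exp borel_measurable_mono[OF mono_clock] by auto
  show "sets ?D = sets borel" "sets ?U = sets borel" by auto
  have D: "emeasure ?D {x<..} = (\<integral>\<^sup>+ s. right_exp f s * indicator {s\<in>{0..<b}. x < clock f s} s \<partial>lborel)"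
    for x
  proof -
    have "emeasure ?D {x<..}
        = emeasure (density lborel (\<lambda>s. right_exp f s * indicator {0..<b} s)) (clock f -` {x<..})"
      using measurable_sets[OF \<open>clock f \<in> borel_measurable borel\<close>, of "{x<..}"]
      by (subst emeasure_distr) auto
    also have "\<dots> = (\<integral>\<^sup>+ s. right_exp f s * indicator {0..<b} s * indicator (clock f -` {x<..}) s \<partial>lborel)"
      using measurable_sets[OF \<open>clock f \<in> borel_measurable borel\<close>, of "{x<..}"]
      by (intro emeasure_density) auto
    also have "\<dots> = (\<integral>\<^sup>+ s. right_exp f s * indicator {s\<in>{0..<b}. x < clock f s} s \<partial>lborel)"
      by (intro nn_integral_cong) (auto simp: indicator_def)
    finally show ?thesis .
  qed
  have U: "emeasure ?U {x<..} = ennreal (clock f b - max 0 x)" if "x < clock f b" for x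
  proof -
    have "emeasure ?U {x<..} = (\<integral>\<^sup>+ s. indicator {0..<clock f b} s * indicator {x<..} s \<partial>lborel)"
      by (rule emeasure_density) auto
    also have "\<dots> = (\<integral>\<^sup>+ s. indicator ({x<..} \<inter> {0..<clock f b}) s \<partial>lborel)"
      by (intro nn_integral_cong) (auto simp: indicator_def)
    also have "\<dots> = emeasure lborel ({x<..} \<inter> {0..<clock f b})"
      by (rule nn_integral_indicator) simp
    also have "{x<..} \<inter> {0..<clock f b} = (if x < 0 then {0..<clock f b} else {x<..<clock f b})"
      by auto
    also have "emeasure lborel \<dots> = ennreal (clock f b - max 0 x)"
      using that clock_nonneg[of b] by auto
    finally show ?thesis .
  qed
  have eq: "emeasure ?D {x<..} = ennreal (clock f b - max 0 x)" if "x < clock f b" for x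
  proof -
    have "max 0 x \<le> clock f b"
      using that clock_nonneg[of b] by auto
    then obtain r where r: "0 \<le> r" "r \<le> b" "clock f r = max 0 x"
      using clock_surj[of b "max 0 x"] assms by auto
    have less: "x < clock f s \<longleftrightarrow> r < s" if "0 < s" for s
      using clock_less_iff[of r s] clock_less[of 0 s] r that by (cases "0 \<le> x") auto
    \<comment> \<open>Up to these points, the times before \<open>b\<close> at which the clock exceeds \<open>x\<close> fill the interval from \<open>r\<close> to \<open>b\<close>.\<close>
    have "AE s in lborel. s \<noteq> 0 \<and> s \<noteq> r \<and> s \<noteq> b"
      by (intro AE_conjI AE_lborel_singleton)
    then have "emeasure ?D {x<..} = (\<integral>\<^sup>+ s. right_exp f s * indicator {r..b} s \<partial>lborel)"
      unfolding D
      by (intro nn_integral_cong_AE, eventually_elim) (use less r in \<open>auto simp: indicator_def\<close>)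
    also have "\<dots> = ennreal (clock f b - max 0 x)"
      using nn_integral_right_exp[OF r(1), of b] clock_add[OF r(1,2)] r(3) by simp
    finally show ?thesis .
  qed
  have ge: "emeasure ?D {x<..} = 0" "emeasure ?U {x<..} = 0" if "clock f b \<le> x" for x
  proof -
    have "clock f s \<le> x" if "s < b" for s
      using monoD[OF mono_clock, of s b] that \<open>clock f b \<le> x\<close> by linarith
    then have "{s\<in>{0..<b}. x < clock f s} = {}" by force
    then show "emeasure ?D {x<..} = 0" unfolding D by simp
    have "emeasure ?U {x<..} = (\<integral>\<^sup>+ s. indicator {0..<clock f b} s * indicator {x<..} s \<partial>lborel)"
      by (rule emeasure_density) auto
    also have "\<dots> = (\<integral>\<^sup>+ s. 0 \<partial>(lborel :: real measure))"
      by (intro nn_integral_cong) (use that in \<open>auto simp: indicator_def\<close>)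
    finally show "emeasure ?U {x<..} = 0" by simp
  qed
  show "emeasure ?D {x<..} = emeasure ?U {x<..}" for x
    using eq[of x] U[of x] ge[of x] by (cases "x < clock f b") auto
  show "emeasure ?D {x<..} < \<infinity>" for x
    using eq[of x] ge(1)[of x] by (cases "x < clock f b") (auto simp: less_top)
qed

lemma nn_integral_clock:
  assumes "0 < b" and g[measurable]: "g \<in> borel_measurable borel"
  shows "(\<integral>\<^sup>+ t. g t * indicator {0..<clock f b} t \<partial>lborel)
    = (\<integral>\<^sup>+ s. right_exp f s * indicator {0..<b} s * g (clock f s) \<partial>lborel)"
proof -
  have [measurable]: "right_exp f \<in> borel_measurable borel" "clock f \<in> borel_measurable borel"
    using borel_measurable_right_exp borel_measurable_mono[OF mono_clock] by auto
  have "(\<integral>\<^sup>+ t. g t * indicator {0..<clock f b} t \<partial>lborel)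
      = (\<integral>\<^sup>+ t. g t \<partial>density lborel (indicator {0..<clock f b}))"
    by (subst nn_integral_density) (auto simp: mult.commute)
  also have "\<dots> = (\<integral>\<^sup>+ s. right_exp f s * indicator {0..<b} s * g (clock f s) \<partial>lborel)"
    unfolding distr_clock[OF \<open>0 < b\<close>, symmetric]
    by (subst nn_integral_distr, simp_all, subst nn_integral_density) auto
  finally show ?thesis .
qed

end

section \<open>The Lamperti path\<close>

lemma cadlag_restrict:
  assumes "cadlag f"
  shows "cadlag (\<lambda>t\<in>{0..}. f t)"
  unfolding cadlag_def continuous_within
proof (intro conjI allI impI)
  fix t :: real assume "0 \<le> t"
  then have "\<forall>\<^sub>F y in at_right t. restrict f {0..} y = f y"
    unfolding eventually_at_right_field by (intro exI[of _ "t + 1"]) auto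
  moreover have "(f \<longlongrightarrow> restrict f {0..} t) (at_right t)"
    using assms \<open>0 \<le> t\<close> by (simp add: cadlag_def continuous_within)
  ultimately show "(restrict f {0..} \<longlongrightarrow> restrict f {0..} t) (at_right t)"
    by (rule tendsto_cong[THEN iffD2])
next
  fix t :: real assume "0 < t"
  then have "\<forall>\<^sub>F y in at_left t. restrict f {0..} y = f y"
    unfolding eventually_at_left_field by (intro exI[of _ 0]) auto
  moreover obtain l where "(f \<longlongrightarrow> l) (at_left t)"
    using assms \<open>0 < t\<close> by (auto simp: cadlag_def)
  ultimately have "(restrict f {0..} \<longlongrightarrow> l) (at_left t)"
    by (rule tendsto_cong[THEN iffD2])
  then show "\<exists>l. (restrict f {0..} \<longlongrightarrow> l) (at_left t)" ..
qed

lemma borel_measurable_cadlag: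
  assumes "cadlag f"
  shows "(\<lambda>t. if 0 \<le> t then f t else 0) \<in> borel_measurable borel"
proof -
  interpret cadlag_path f by standard fact
  note [measurable] = borel_measurable_exp_path
  have "(\<lambda>t. ln (if 0 \<le> t then exp (f t) else 0)) \<in> borel_measurable borel"
    by measurable
  also have "(\<lambda>t. ln (if 0 \<le> t then exp (f t) else 0)) = (\<lambda>t. if 0 \<le> t then f t else 0)"
    by auto
  finally show ?thesis .
qed

lemma filterlim_at_rightI:
  fixes g :: "'b \<Rightarrow> real"
  assumes "\<And>c. s < c \<Longrightarrow> \<forall>\<^sub>F u in F. s < g u \<and> g u < c"
  shows "filterlim g (at_right s) F"
  unfolding filterlim_iff
proof (intro allI impI)
  fix P assume "eventually P (at_right s)"
  then obtain c where "s < c" "\<And>y. s < y \<Longrightarrow> y < c \<Longrightarrow> P y"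
    unfolding eventually_at_right_field by blast
  with assms[of c] show "\<forall>\<^sub>F u in F. P (g u)"
    by (auto elim: eventually_mono)
qed

lemma filterlim_at_leftI:
  fixes g :: "'b \<Rightarrow> real"
  assumes "\<And>c. c < s \<Longrightarrow> \<forall>\<^sub>F u in F. c < g u \<and> g u < s"
  shows "filterlim g (at_left s) F"
  unfolding filterlim_iff
proof (intro allI impI)
  fix P assume "eventually P (at_left s)"
  then obtain c where "c < s" "\<And>y. c < y \<Longrightarrow> y < s \<Longrightarrow> P y"
    unfolding eventually_at_left_field by blast
  with assms[of c] show "\<forall>\<^sub>F u in F. P (g u)"
    by (auto elim: eventually_mono)
qed

text \<open>The inner integral is the Lebesgue measure of the times up to \<open>b\<close> at which the clock has not
passed \<open>t\<close>; for an increasing clock it is the inverse of the clock at \<open>t\<close>. In this form the inverse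
is visibly measurable in \<open>t\<close> and the path jointly.\<close>

definition right_lamperti :: "(real \<Rightarrow> real) \<Rightarrow> real \<Rightarrow> real \<Rightarrow> real" where
  "right_lamperti f b t =
     (if t < right_clock f b
      then enn2real (right_exp f
        (enn2real (\<integral>\<^sup>+ r. (if 0 \<le> r \<and> r \<le> b \<and> right_clock f r \<le> t then 1 else 0) \<partial>lborel)))
      else 0)"

locale killed_path =
  fixes \<xi> :: "real \<Rightarrow> 'a \<Rightarrow> real" and e :: "'a \<Rightarrow> real" and \<omega> :: 'a
  assumes cadlag_\<xi>: "cadlag (\<lambda>t. \<xi> t \<omega>)" and lifetime_pos: "0 < e \<omega>"
begin

sublocale cadlag_path "\<lambda>t. \<xi> t \<omega>"
  by standard (rule cadlag_\<xi>)

abbreviation A :: "real \<Rightarrow> real" where "A \<equiv> clock (\<lambda>t. \<xi> t \<omega>)"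
abbreviation L :: "real \<Rightarrow> real" where "L t \<equiv> lamperti \<xi> e 1 t \<omega>"

lemma exp_functional_eq_clock: "exp_functional \<xi> e \<omega> = A (e \<omega>)"
  by (simp add: exp_functional_def clock_def)

lemma integral_exp_killed:
  assumes "0 \<le> r"
  shows "(LBINT t:{0..r}. exp_killed \<xi> e t \<omega>) = A (min r (e \<omega>))"
  unfolding clock_def set_lebesgue_integral_def
proof (rule integral_cong_AE)
  note [measurable] = borel_measurable_exp_path
  have "(\<lambda>t. indicator {0..r} t *\<^sub>R exp_killed \<xi> e t \<omega>)
      = (\<lambda>t. indicator {0..r} t * (if t < e \<omega> then (if 0 \<le> t then exp (\<xi> t \<omega>) else 0) else 0))"
    by (auto simp: exp_killed_def indicator_def)
  also have "\<dots> \<in> borel_measurable lborel"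
    by measurable
  finally show "(\<lambda>t. indicator {0..r} t *\<^sub>R exp_killed \<xi> e t \<omega>) \<in> borel_measurable lborel" .
  show "(\<lambda>t. indicator {0..min r (e \<omega>)} t *\<^sub>R exp (\<xi> t \<omega>)) \<in> borel_measurable lborel"
    using exp_integrable[of 0 "min r (e \<omega>)"] unfolding set_integrable_def by auto
  show "AE t in lborel. indicator {0..r} t *\<^sub>R exp_killed \<xi> e t \<omega>
      = indicator {0..min r (e \<omega>)} t *\<^sub>R exp (\<xi> t \<omega>)"
    using AE_lborel_singleton[of "e \<omega>"]
    by eventually_elim (auto simp: exp_killed_def indicator_def)
qed

lemma time_change_clock:
  assumes "0 \<le> s" "s < e \<omega>"
  shows "time_change \<xi> e (A s) \<omega> = ereal s"
proof -
  have "{r. 0 < r \<and> A s < (LBINT t:{0..r}. exp_killed \<xi> e t \<omega>)} = {s<..}"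
    using assms lifetime_pos by (auto simp: integral_exp_killed clock_less_iff)
  moreover have "Inf (ereal ` {s<..}) = ereal s"
  proof (rule Inf_eqI)
    fix y assume y: "\<And>i. i \<in> ereal ` {s<..} \<Longrightarrow> y \<le> i"
    show "y \<le> ereal s"
    proof (cases y)
      case (real z)
      have "z \<le> r" if "s < r" for r
        using y[of "ereal r"] real that by simp
      then have "z \<le> s" by (rule dense_ge)
      then show ?thesis using real by simp
    next
      case PInf
      then show ?thesis using y[of "ereal (s + 1)"] by simp
    qed simp
  next
    show "ereal s \<le> i" if "i \<in> ereal ` {s<..}" for i
      using that by force
  qed
  ultimately show ?thesis
    by (simp add: time_change_def)
qed

lemma time_change_infinity:
  assumes "A (e \<omega>) \<le> t"
  shows "time_change \<xi> e t \<omega> = \<infinity>"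
proof -
  have "\<not> (0 < r \<and> t < (LBINT t:{0..r}. exp_killed \<xi> e t \<omega>))" for r
    using assms lifetime_pos monoD[OF mono_clock, of "min r (e \<omega>)" "e \<omega>"]
    by (auto simp: integral_exp_killed)
  then have "{r. 0 < r \<and> t < (LBINT t:{0..r}. exp_killed \<xi> e t \<omega>)} = {}"
    by blast
  then show ?thesis
    unfolding time_change_def by (simp add: top_ereal_def del: Collect_empty_eq)
qed

lemma lamperti_clock: "0 \<le> s \<Longrightarrow> s < e \<omega> \<Longrightarrow> L (A s) = exp (\<xi> s \<omega>)"
  by (simp add: lamperti_def time_change_clock exp_killed_def)

lemma lamperti_absorbed: "A (e \<omega>) \<le> t \<Longrightarrow> L t = 0"
  by (simp add: lamperti_def time_change_infinity)

lemma clock_cases: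
  assumes "0 \<le> t"
  obtains (alive) s where "0 \<le> s" "s < e \<omega>" "t = A s" | (dead) "A (e \<omega>) \<le> t"
proof (cases "t < A (e \<omega>)")
  case True
  then obtain s where "0 \<le> s" "s \<le> e \<omega>" "A s = t"
    using clock_surj[of "e \<omega>" t] assms lifetime_pos by auto
  with True have "s \<noteq> e \<omega>" by auto
  with \<open>0 \<le> s\<close> \<open>s \<le> e \<omega>\<close> \<open>A s = t\<close> show ?thesis by (intro alive[of s]) auto
qed (use dead in auto)

lemma right_clock_eq: "right_clock (\<lambda>t. \<xi> t \<omega>) = A"
  by (auto simp: right_clock_def clock_eq_nn_integral)

lemma right_lamperti_eq:
  assumes "0 \<le> t"
  shows "right_lamperti (\<lambda>t. \<xi> t \<omega>) (e \<omega>) t = L t"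
  using assms
proof (cases t rule: clock_cases)
  case (alive s)
  have "(\<integral>\<^sup>+ r. (if 0 \<le> r \<and> r \<le> e \<omega> \<and> A r \<le> t then 1 else 0) \<partial>lborel)
      = (\<integral>\<^sup>+ r. indicator {0..s} r \<partial>lborel)"
    using alive by (intro nn_integral_cong) (auto simp: indicator_def clock_le_iff)
  also have "\<dots> = ennreal s"
    using alive by simp
  finally show ?thesis
    using alive clock_less_iff[of s "e \<omega>"]
    by (simp add: right_lamperti_def right_clock_eq lamperti_clock right_exp_eq[OF cadlag_\<xi>])
next
  case dead
  then show ?thesis
    by (simp add: right_lamperti_def right_clock_eq lamperti_absorbed)
qed

text \<open>The clock is injective on the lifetime, so there is only one candidate for every reading \<open>u\<close> that it
takes before the killing time.\<close>

definition inv_clock :: "real \<Rightarrow> real" where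
  "inv_clock u = (SOME s. 0 \<le> s \<and> s < e \<omega> \<and> A s = u)"

lemma inv_clock:
  assumes "0 \<le> u" "u < A (e \<omega>)"
  shows "0 \<le> inv_clock u" "inv_clock u < e \<omega>" "A (inv_clock u) = u" "L u = exp (\<xi> (inv_clock u) \<omega>)"
proof -
  have "\<exists>s. 0 \<le> s \<and> s < e \<omega> \<and> A s = u"
    using assms(1) by (cases u rule: clock_cases) (use assms(2) in auto)
  from someI_ex[OF this] show *: "0 \<le> inv_clock u" "inv_clock u < e \<omega>" "A (inv_clock u) = u"
    by (auto simp: inv_clock_def)
  then show "L u = exp (\<xi> (inv_clock u) \<omega>)"
    using lamperti_clock[of "inv_clock u"] by simp
qed

text \<open>The inverse clock is not only continuous but approaches its limit strictly from the same side. This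
carries one-sided limits of \<open>\<xi>\<close> over to one-sided limits of the Lamperti path.\<close>

lemma inv_clock_at_right:
  assumes "0 \<le> s" "s < e \<omega>"
  shows "filterlim inv_clock (at_right s) (at_right (A s))"
proof (rule filterlim_at_rightI)
  fix c assume "s < c"
  let ?c = "min c (e \<omega>)"
  have "s < inv_clock u \<and> inv_clock u < c" if u: "A s < u" "u < A ?c" for u
  proof -
    have "0 \<le> u" "u < A (e \<omega>)"
      using u clock_nonneg[of s] monoD[OF mono_clock, of ?c "e \<omega>"] by linarith+
    note inv = inv_clock[OF this]
    have "s < inv_clock u"
      using clock_less_iff[of s "inv_clock u"] inv(1,3) u(1) assms(1) by simp
    moreover have "inv_clock u < ?c"
      using clock_less_iff[of "inv_clock u" ?c] inv(1,3) u(2) assms(1) lifetime_pos \<open>s < c\<close> by simp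
    ultimately show ?thesis by simp
  qed
  moreover have "A s < A ?c"
    using assms \<open>s < c\<close> by (intro clock_less) auto
  ultimately show "\<forall>\<^sub>F u in at_right (A s). s < inv_clock u \<and> inv_clock u < c"
    unfolding eventually_at_right_field by blast
qed

lemma inv_clock_at_left:
  assumes "0 < s" "s \<le> e \<omega>"
  shows "filterlim inv_clock (at_left s) (at_left (A s))"
proof (rule filterlim_at_leftI)
  fix c assume "c < s"
  let ?c = "max c 0"
  have "c < inv_clock u \<and> inv_clock u < s" if u: "A ?c < u" "u < A s" for u
  proof -
    have "0 \<le> u" "u < A (e \<omega>)"
      using u clock_nonneg[of ?c] monoD[OF mono_clock, of s "e \<omega>"] assms by linarith+
    note inv = inv_clock[OF this]
    have "?c < inv_clock u"
      using clock_less_iff[of ?c "inv_clock u"] inv(1,3) u(1) by simp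
    moreover have "inv_clock u < s"
      using clock_less_iff[of "inv_clock u" s] inv(1,3) u(2) assms(1) by simp
    ultimately show ?thesis by simp
  qed
  moreover have "A ?c < A s"
    using assms \<open>c < s\<close> by (intro clock_less) auto
  ultimately show "\<forall>\<^sub>F u in at_left (A s). c < inv_clock u \<and> inv_clock u < s"
    unfolding eventually_at_left_field by blast
qed

text \<open>At the absorption time the left limit involves \<open>\<xi>\<close> just before the killing time, which is finite;
from there on the path is constant.\<close>

lemma cadlag_lamperti: "cadlag L"
  unfolding cadlag_def continuous_within
proof (intro conjI allI impI)
  fix t :: real assume "0 \<le> t"
  then show "(L \<longlongrightarrow> L t) (at_right t)"
  proof (cases t rule: clock_cases)
    case (alive s)
    have "((\<lambda>r. \<xi> r \<omega>) \<longlongrightarrow> \<xi> s \<omega>) (at_right s)"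
      using cadlag_\<xi> alive by (auto simp: cadlag_def continuous_within)
    then have "((\<lambda>u. exp (\<xi> (inv_clock u) \<omega>)) \<longlongrightarrow> exp (\<xi> s \<omega>)) (at_right t)"
      unfolding \<open>t = A s\<close>
      by (intro tendsto_exp filterlim_compose[OF _ inv_clock_at_right]) (use alive in auto)
    moreover have "\<forall>\<^sub>F u in at_right t. L u = exp (\<xi> (inv_clock u) \<omega>)"
      unfolding eventually_at_right_field
      by (intro exI[of _ "A (e \<omega>)"])
         (use alive \<open>0 \<le> t\<close> clock_less[of s "e \<omega>"] in \<open>auto intro!: inv_clock(4)\<close>)
    ultimately show ?thesis
      using tendsto_cong alive lamperti_clock by force
  next
    case dead
    then have "\<forall>\<^sub>F u in at_right t. L u = 0"
      unfolding eventually_at_right_field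
      by (intro exI[of _ "t + 1"]) (auto intro!: lamperti_absorbed)
    then show ?thesis
      using dead by (auto simp: lamperti_absorbed intro: tendsto_eventually)
  qed
next
  fix t :: real assume "0 < t"
  show "\<exists>l. (L \<longlongrightarrow> l) (at_left t)"
  proof (cases "t \<le> A (e \<omega>)")
    case True
    then obtain s where s: "0 \<le> s" "s \<le> e \<omega>" "A s = t"
      using clock_surj[of "e \<omega>" t] \<open>0 < t\<close> lifetime_pos by auto
    with \<open>0 < t\<close> have "0 < s" by (cases "s = 0") auto
    then obtain l where "((\<lambda>r. \<xi> r \<omega>) \<longlongrightarrow> l) (at_left s)"
      using cadlag_\<xi> by (auto simp: cadlag_def)
    then have "((\<lambda>u. exp (\<xi> (inv_clock u) \<omega>)) \<longlongrightarrow> exp l) (at_left t)"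
      unfolding \<open>A s = t\<close>[symmetric]
      by (intro tendsto_exp filterlim_compose[OF _ inv_clock_at_left]) (use s \<open>0 < s\<close> in auto)
    moreover have "\<forall>\<^sub>F u in at_left t. L u = exp (\<xi> (inv_clock u) \<omega>)"
      unfolding eventually_at_left_field
      by (intro exI[of _ 0]) (use True \<open>0 < t\<close> in \<open>auto intro!: inv_clock(4)\<close>)
    ultimately show ?thesis
      using tendsto_cong by force
  next
    case False
    then have "\<forall>\<^sub>F u in at_left t. L u = 0"
      unfolding eventually_at_left_field
      by (intro exI[of _ "A (e \<omega>)"]) (auto intro!: lamperti_absorbed)
    then show ?thesis
      by (auto intro: tendsto_eventually)
  qed
qed

lemma lamperti_nonneg: "0 \<le> L t"
  by (simp add: lamperti_def exp_killed_def)

lemma lamperti_eq_0_iff: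
  assumes "0 \<le> t"
  shows "L t = 0 \<longleftrightarrow> A (e \<omega>) \<le> t"
  using assms
proof (cases t rule: clock_cases)
  case (alive s)
  then show ?thesis
    using clock_less[of s "e \<omega>"] by (simp add: lamperti_clock)
qed (simp add: lamperti_absorbed)

lemma lamperti_in_path_space: "(\<lambda>t\<in>{0..}. L t) \<in> space path_space"
  using cadlag_restrict[OF cadlag_lamperti] lamperti_nonneg
  by (auto simp: path_space_def space_restrict_space space_PiM lamperti_eq_0_iff)

text \<open>The heart of the argument. With \<open>t = A s\<close> the weight \<open>1 / L t = exp (- \<xi> s)\<close> cancels the Jacobian
\<open>exp (\<xi> s)\<close> exactly, and beyond the absorption time the integrand vanishes because \<open>1 / 0 = 0\<close>.\<close>

lemma nn_integral_inverse_lamperti: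
  assumes [measurable]: "g \<in> borel_measurable borel"
  shows "(\<integral>\<^sup>+ t. ennreal (1 / L t) * g t * indicator {0..} t \<partial>lborel)
    = (\<integral>\<^sup>+ s. g (A s) * indicator {0..<e \<omega>} s \<partial>lborel)"
proof -
  note [measurable] = borel_measurable_cadlag[OF cadlag_lamperti]
  have "(\<integral>\<^sup>+ t. ennreal (1 / L t) * g t * indicator {0..} t \<partial>lborel)
      = (\<integral>\<^sup>+ t. (ennreal (1 / (if 0 \<le> t then L t else 0)) * g t) * indicator {0..<A (e \<omega>)} t \<partial>lborel)"
    by (intro nn_integral_cong) (auto simp: indicator_def lamperti_absorbed)
  also have "\<dots> = (\<integral>\<^sup>+ s. right_exp (\<lambda>t. \<xi> t \<omega>) s * indicator {0..<e \<omega>} s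
      * (ennreal (1 / (if 0 \<le> A s then L (A s) else 0)) * g (A s)) \<partial>lborel)"
    by (rule nn_integral_clock[OF lifetime_pos]) measurable
  also have "\<dots> = (\<integral>\<^sup>+ s. g (A s) * indicator {0..<e \<omega>} s \<partial>lborel)"
  proof (intro nn_integral_cong)
    fix s
    have "right_exp (\<lambda>t. \<xi> t \<omega>) s * (ennreal (1 / L (A s)) * g (A s)) = g (A s)"
      if "0 \<le> s" "s < e \<omega>"
      using that by (simp add: right_exp_eq[OF cadlag_\<xi>] lamperti_clock mult.assoc[symmetric]
          ennreal_mult[symmetric])
    then show "right_exp (\<lambda>t. \<xi> t \<omega>) s * indicator {0..<e \<omega>} s
        * (ennreal (1 / (if 0 \<le> A s then L (A s) else 0)) * g (A s))
      = g (A s) * indicator {0..<e \<omega>} s"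
      using clock_nonneg[of s] by (auto simp: indicator_def)
  qed
  finally show ?thesis .
qed

end

section \<open>The hitting time of zero and the canonical space\<close>

text \<open>If \<open>X t = 0\<close>, absorption puts zeros at all later times, so the hitting time is at most \<open>t\<close>, even for
\<open>t = 0\<close>, although the infimum ranges over positive times only. Conversely, right continuity keeps a path
that is positive at \<open>t\<close> positive for a while longer, and this makes the inequality strict.
Thus the event on the left depends on one coordinate, so that it is measurable.\<close>

lemma less_hit_zero_iff:
  assumes X: "X \<in> space path_space" and t: "0 \<le> t"
  shows "ereal t < hit_zero X \<longleftrightarrow> X t \<noteq> 0"
proof -
  have cad: "cadlag X" and abs: "\<And>s t. 0 \<le> s \<Longrightarrow> s \<le> t \<Longrightarrow> X s = 0 \<Longrightarrow> X t = 0"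
    and nonneg: "0 \<le> X t"
    using X t by (auto simp: path_space_def space_restrict_space)
  have "X t \<noteq> 0" if "ereal t < hit_zero X"
  proof
    assume "X t = 0"
    then have "hit_zero X \<le> ereal u" if "t < u" for u
      using abs[of t u] t that unfolding hit_zero_def by (intro Inf_lower) auto
    moreover obtain u where "ereal t < ereal u" "ereal u < hit_zero X"
      using ereal_dense2[OF \<open>ereal t < hit_zero X\<close>] by blast
    ultimately show False
      by (auto simp: not_less[symmetric])
  qed
  moreover have "ereal t < hit_zero X" if "X t \<noteq> 0"
  proof -
    have "0 < X t" using nonneg \<open>X t \<noteq> 0\<close> by simp
    have "(X \<longlongrightarrow> X t) (at_right t)"
      using cad t by (auto simp: cadlag_def continuous_within)
    from order_tendstoD(1)[OF this \<open>0 < X t\<close>]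
    obtain c where c: "t < c" "\<And>u. t < u \<Longrightarrow> u < c \<Longrightarrow> 0 < X u"
      unfolding eventually_at_right_field by blast
    have "ereal t < ereal c" using c(1) by simp
    also have "ereal c \<le> hit_zero X"
      unfolding hit_zero_def
    proof (rule Inf_greatest, safe)
      fix u :: real assume "0 < u" "X u = 0"
      then have "\<not> u \<le> t" using abs[of u t] \<open>X t \<noteq> 0\<close> by auto
      with c(2)[of u] \<open>X u = 0\<close> show "ereal c \<le> ereal u" by force
    qed
    finally show ?thesis .
  qed
  ultimately show ?thesis by blast
qed

section \<open>Joint measurability in time and path\<close>

lemma borel_measurable_right_clock_pair:
  assumes "\<And>t. 0 \<le> t \<Longrightarrow> \<xi> t \<in> borel_measurable N"
  shows "(\<lambda>p. right_clock (\<lambda>t. \<xi> t (snd p)) (fst p)) \<in> borel_measurable (borel \<Otimes>\<^sub>M N)"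
proof -
  have "(\<lambda>x. right_exp (\<lambda>u. \<xi> u (snd (fst x))) (snd x))
      \<in> borel_measurable ((borel \<Otimes>\<^sub>M N) \<Otimes>\<^sub>M lborel)"
    using measurable_compose[of "\<lambda>x. (snd x, snd (fst x))" "(borel \<Otimes>\<^sub>M N) \<Otimes>\<^sub>M lborel" "borel \<Otimes>\<^sub>M N",
        OF _ borel_measurable_right_exp_pair[OF assms]] by simp
  then have [measurable]: "(\<lambda>x. if 0 \<le> snd x \<and> snd x \<le> fst (fst x)
        then right_exp (\<lambda>u. \<xi> u (snd (fst x))) (snd x) else 0)
      \<in> borel_measurable ((borel \<Otimes>\<^sub>M N) \<Otimes>\<^sub>M lborel)"
    by measurable
  have "(\<lambda>p. enn2real (\<integral>\<^sup>+ t. (if 0 \<le> t \<and> t \<le> fst p then right_exp (\<lambda>u. \<xi> u (snd p)) t else 0) \<partial>lborel))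
      \<in> borel_measurable (borel \<Otimes>\<^sub>M N)"
    by (intro borel_measurable_enn2real lborel.borel_measurable_nn_integral)
       (simp add: case_prod_beta')
  also have "(\<lambda>p. enn2real (\<integral>\<^sup>+ t. (if 0 \<le> t \<and> t \<le> fst p then right_exp (\<lambda>u. \<xi> u (snd p)) t else 0) \<partial>lborel))
      = (\<lambda>p. right_clock (\<lambda>t. \<xi> t (snd p)) (fst p))"
    unfolding right_clock_def
    by (intro ext arg_cong[where f=enn2real] nn_integral_cong) (auto simp: indicator_def)
  finally show ?thesis .
qed

lemma borel_measurable_right_lamperti_pair:
  assumes "\<And>t. 0 \<le> t \<Longrightarrow> \<xi> t \<in> borel_measurable N" and [measurable]: "b \<in> borel_measurable N"
  shows "(\<lambda>p. right_lamperti (\<lambda>t. \<xi> t (snd p)) (b (snd p)) (fst p)) \<in> borel_measurable (borel \<Otimes>\<^sub>M N)"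
proof -
  let ?B = "borel \<Otimes>\<^sub>M N :: (real \<times> 'a) measure"
  note clock = borel_measurable_right_clock_pair[OF assms(1)]
  note exp = borel_measurable_right_exp_pair[OF assms(1)]
  have [measurable]: "(\<lambda>x. right_clock (\<lambda>u. \<xi> u (snd (fst x))) (snd x)) \<in> borel_measurable (?B \<Otimes>\<^sub>M lborel)"
    using measurable_compose[of "\<lambda>x. (snd x, snd (fst x))" "?B \<Otimes>\<^sub>M lborel" ?B, OF _ clock] by simp
  have [measurable]: "(\<lambda>p. right_clock (\<lambda>u. \<xi> u (snd p)) (b (snd p))) \<in> borel_measurable ?B"
    using measurable_compose[of "\<lambda>p. (b (snd p), snd p)" ?B ?B, OF _ clock] by simp
  let ?ind = "\<lambda>p r. if 0 \<le> r \<and> r \<le> b (snd p) \<and> right_clock (\<lambda>u. \<xi> u (snd p)) r \<le> fst p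
      then 1 else 0 :: ennreal"
  let ?\<tau> = "\<lambda>p. enn2real (\<integral>\<^sup>+ r. ?ind p r \<partial>lborel)"
  have [measurable]: "?\<tau> \<in> borel_measurable ?B"
    by (intro borel_measurable_enn2real lborel.borel_measurable_nn_integral) measurable
  have [measurable]: "(\<lambda>p. right_exp (\<lambda>u. \<xi> u (snd p)) (?\<tau> p)) \<in> borel_measurable ?B"
    using measurable_compose[of "\<lambda>p. (?\<tau> p, snd p)" ?B ?B, OF _ exp] by simp
  have "(\<lambda>p. if fst p < right_clock (\<lambda>u. \<xi> u (snd p)) (b (snd p))
      then enn2real (right_exp (\<lambda>u. \<xi> u (snd p)) (?\<tau> p)) else 0) \<in> borel_measurable ?B"
    by measurable
  then show ?thesis
    unfolding right_lamperti_def .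
qed

section \<open>Modification on null sets under a completed measure\<close>

lemma measurable_completion_AE:
  assumes g: "g \<in> measurable M N" and f: "f \<in> space M \<rightarrow> space N"
    and ae: "AE x in M. f x = g x"
  shows "f \<in> measurable (completion M) N"
proof (rule measurableI)
  fix B assume "B \<in> sets N"
  have "g -` B \<inter> space M \<in> sets (completion M)"
    using measurable_sets[OF g \<open>B \<in> sets N\<close>] by simp
  moreover have "AE x in completion M. x \<in> g -` B \<inter> space M \<longleftrightarrow> x \<in> f -` B \<inter> space M"
    using AE_completion[OF ae] by eventually_elim auto
  ultimately show "f -` B \<inter> space (completion M) \<in> sets (completion M)"
    using completion.in_sets_AE[of "g -` B \<inter> space M" "f -` B \<inter> space M" M] by simp
qed (use f in auto)

text \<open>The map \<open>f\<close> may leave the space of \<open>N\<close> on a null set and so fail to be measurable into \<open>N\<close>. Its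
preimages of measurable sets are measurable all the same, and this is what the image measure needs.
The law of the Lamperti process is of this kind.\<close>

lemma distr_completion_AE:
  assumes g: "g \<in> measurable (completion M) N" and ae: "AE x in completion M. f x = g x"
  shows "distr (completion M) N f = distr (completion M) N g"
  unfolding distr_def
proof (rule measure_of_eq)
  fix B assume "B \<in> sigma_sets (space N) (sets N)"
  then have "B \<in> sets N"
    by (simp add: sets.sigma_sets_eq)
  have 1: "g -` B \<inter> space (completion M) \<in> sets (completion M)"
    using measurable_sets[OF g \<open>B \<in> sets N\<close>] .
  have 2: "AE x in completion M. x \<in> g -` B \<inter> space (completion M) \<longleftrightarrow> x \<in> f -` B \<inter> space (completion M)"
    using ae by eventually_elim auto
  have 3: "f -` B \<inter> space (completion M) \<in> sets (completion M)"
    using completion.in_sets_AE[OF 2 1] by simp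
  show "emeasure (completion M) (f -` B \<inter> space (completion M))
      = emeasure (completion M) (g -` B \<inter> space (completion M))"
    by (rule emeasure_eq_AE) (use 1 2 3 in auto)
qed (rule sets.space_closed)

section \<open>An independent exponential horizon\<close>

lemma measurable_ident_sub_algebra:
  assumes "sets F \<subseteq> sets M" "space F = space M"
  shows "(\<lambda>\<omega>. \<omega>) \<in> measurable M F"
  using assms by (auto simp: measurable_def Int_absorb2 sets.sets_into_space)

context prob_space
begin

text \<open>If \<open>e\<close> is independent of the sub-sigma-algebra \<open>F\<close>, then the pair of \<open>e\<close> and the identity map into \<open>F\<close>
has a product law. Taking the identity as second variable covers all functionals of a process that
generates \<open>F\<close> at once.\<close>

lemma nn_integral_indep:
  assumes e[measurable]: "e \<in> borel_measurable M"
    and F: "sets F \<subseteq> events" "space F = space M"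
    and indep: "indep_set (sets (vimage_algebra (space M) e borel)) (sets F)"
    and G: "G \<in> borel_measurable (borel \<Otimes>\<^sub>M F)"
  shows "(\<integral>\<^sup>+ \<omega>. G (e \<omega>, \<omega>) \<partial>M) = (\<integral>\<^sup>+ s. \<integral>\<^sup>+ \<omega>. G (s, \<omega>) \<partial>M \<partial>distr M borel e)"
proof -
  have id[measurable]: "(\<lambda>\<omega>. \<omega>) \<in> measurable M F"
    using F by (rule measurable_ident_sub_algebra)
  interpret E: prob_space "distr M borel e" by (rule prob_space_distr) simp
  interpret W: prob_space "distr M F (\<lambda>\<omega>. \<omega>)" by (rule prob_space_distr) simp
  have "distr M borel e \<Otimes>\<^sub>M distr M F (\<lambda>\<omega>. \<omega>) = distr M (borel \<Otimes>\<^sub>M F) (\<lambda>\<omega>. (e \<omega>, \<omega>))"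
  proof (rule pair_measure_eqI)
    fix B D assume "B \<in> sets (distr M borel e)" "D \<in> sets (distr M F (\<lambda>\<omega>. \<omega>))"
    then have [measurable]: "B \<in> sets borel" "D \<in> sets F" by auto
    have "D \<inter> space M = D"
      using sets.sets_into_space[OF \<open>D \<in> sets F\<close>] F by auto
    have "(\<lambda>\<omega>. (e \<omega>, \<omega>)) -` (B \<times> D) \<inter> space M = (e -` B \<inter> space M) \<inter> D"
      using \<open>D \<inter> space M = D\<close> by auto
    moreover have "prob ((e -` B \<inter> space M) \<inter> D) = prob (e -` B \<inter> space M) * prob D"
      by (rule indep_setD[OF indep]) (auto intro: in_vimage_algebra)
    ultimately show "emeasure (distr M borel e) B * emeasure (distr M F (\<lambda>\<omega>. \<omega>)) D
        = emeasure (distr M (borel \<Otimes>\<^sub>M F) (\<lambda>\<omega>. (e \<omega>, \<omega>))) (B \<times> D)"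
      using \<open>D \<inter> space M = D\<close>
      by (simp add: emeasure_distr emeasure_eq_measure ennreal_mult)
  qed (auto intro: E.sigma_finite_measure_axioms W.sigma_finite_measure_axioms)
  note pair = this
  have "(\<integral>\<^sup>+ \<omega>. G (e \<omega>, \<omega>) \<partial>M) = (\<integral>\<^sup>+ p. G p \<partial>distr M (borel \<Otimes>\<^sub>M F) (\<lambda>\<omega>. (e \<omega>, \<omega>)))"
    using G by (subst nn_integral_distr) auto
  also have "\<dots> = (\<integral>\<^sup>+ s. \<integral>\<^sup>+ \<omega>. G (s, \<omega>) \<partial>distr M F (\<lambda>\<omega>. \<omega>) \<partial>distr M borel e)"
    unfolding pair[symmetric] using G by (intro W.nn_integral_fst[symmetric]) simp
  also have "\<dots> = (\<integral>\<^sup>+ s. \<integral>\<^sup>+ \<omega>. G (s, \<omega>) \<partial>M \<partial>distr M borel e)"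
    using G by (intro nn_integral_cong nn_integral_distr) auto
  finally show ?thesis .
qed

text \<open>The exponential law is the one whose density is \<open>q\<close> times its tail. Evaluating \<open>G\<close> at the
horizon integrates its mean against the density; integrating \<open>G\<close> up to the horizon
integrates the same mean against the tail.\<close>

lemma nn_integral_exponential_horizon:
  assumes D: "distributed M lborel e (exponential_density q)" and "0 < q"
    and F: "sets F \<subseteq> events" "space F = space M"
    and indep: "indep_set (sets (vimage_algebra (space M) e borel)) (sets F)"
    and G: "G \<in> borel_measurable (borel \<Otimes>\<^sub>M F)"
  shows "ennreal q * (\<integral>\<^sup>+ \<omega>. \<integral>\<^sup>+ s. G (s, \<omega>) * indicator {0..<e \<omega>} s \<partial>lborel \<partial>M)
    = (\<integral>\<^sup>+ \<omega>. G (e \<omega>, \<omega>) \<partial>M)"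
proof -
  have e[measurable]: "e \<in> borel_measurable M"
    using distributed_measurable[OF D] by simp
  have [measurable]: "(\<lambda>\<omega>. \<omega>) \<in> measurable M F"
    using F by (rule measurable_ident_sub_algebra)
  have law: "distr M borel e = density lborel (exponential_density q)"
    using distributed_distr_eq_density[OF D] by (simp cong: distr_cong)
  interpret E: prob_space "distr M borel e" by (rule prob_space_distr) simp
  interpret ME: pair_sigma_finite M lborel ..
  interpret EL: pair_sigma_finite "distr M borel e" lborel ..
  have "(\<lambda>p. (fst p, snd p)) \<in> measurable (borel \<Otimes>\<^sub>M M) (borel \<Otimes>\<^sub>M F)"
    by measurable
  from measurable_compose[OF this G]
  have [measurable]: "G \<in> borel_measurable (borel \<Otimes>\<^sub>M M)"
    by simp
  define \<Gamma> where "\<Gamma> s = (\<integral>\<^sup>+ \<omega>. G (s, \<omega>) \<partial>M)" for s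
  have \<Gamma>[measurable]: "\<Gamma> \<in> borel_measurable borel"
    unfolding \<Gamma>_def by (rule borel_measurable_nn_integral) (simp add: case_prod_eta)
  let ?i = "\<lambda>s u :: real. if 0 \<le> s \<and> s < u then 1 else 0 :: ennreal"
  have tail: "(\<integral>\<^sup>+ u. ?i s u \<partial>distr M borel e) = (if 0 \<le> s then ennreal (exp (- s * q)) else 0)" for s
  proof (cases "0 \<le> s")
    case True
    have "(\<integral>\<^sup>+ u. ?i s u \<partial>distr M borel e) = (\<integral>\<^sup>+ u. indicator {s<..} u \<partial>distr M borel e)"
      using True by (intro nn_integral_cong) auto
    also have "\<dots> = emeasure M {\<omega> \<in> space M. s < e \<omega>}"
      by (subst nn_integral_indicator, simp, subst emeasure_distr)
         (auto intro!: arg_cong[where f="emeasure M"])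
    also have "\<dots> = ennreal (exp (- s * q))"
      using exponential_distributedD_gt[OF D True \<open>0 < q\<close>] by (simp add: emeasure_eq_measure)
    finally show ?thesis using True by simp
  qed simp
  have "(\<integral>\<^sup>+ \<omega>. \<integral>\<^sup>+ s. G (s, \<omega>) * indicator {0..<e \<omega>} s \<partial>lborel \<partial>M)
      = (\<integral>\<^sup>+ \<omega>. \<integral>\<^sup>+ s. G (s, \<omega>) * ?i s (e \<omega>) \<partial>lborel \<partial>M)"
    by (intro nn_integral_cong) (auto simp: indicator_def)
  also have "\<dots> = (\<integral>\<^sup>+ u. \<integral>\<^sup>+ \<omega>. \<integral>\<^sup>+ s. G (s, \<omega>) * ?i s u \<partial>lborel \<partial>M \<partial>distr M borel e)"
  proof -
    have [measurable]: "(\<lambda>x. G (snd x, snd (fst x))) \<in> borel_measurable ((borel \<Otimes>\<^sub>M F) \<Otimes>\<^sub>M lborel)"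
      using G by measurable
    have "(\<lambda>p. \<integral>\<^sup>+ s. G (s, snd p) * ?i s (fst p) \<partial>lborel) \<in> borel_measurable (borel \<Otimes>\<^sub>M F)"
      by (intro lborel.borel_measurable_nn_integral) measurable
    from nn_integral_indep[OF e F indep this] show ?thesis by simp
  qed
  also have "\<dots> = (\<integral>\<^sup>+ u. \<integral>\<^sup>+ s. \<Gamma> s * ?i s u \<partial>lborel \<partial>distr M borel e)"
  proof (rule nn_integral_cong)
    fix u :: real
    have "(\<integral>\<^sup>+ \<omega>. \<integral>\<^sup>+ s. G (s, \<omega>) * ?i s u \<partial>lborel \<partial>M) = (\<integral>\<^sup>+ s. \<integral>\<^sup>+ \<omega>. G (s, \<omega>) * ?i s u \<partial>M \<partial>lborel)"
      by (rule ME.Fubini'[symmetric]) measurable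
    also have "\<dots> = (\<integral>\<^sup>+ s. \<Gamma> s * ?i s u \<partial>lborel)"
      unfolding \<Gamma>_def by (intro nn_integral_cong nn_integral_multc) measurable
    finally show "(\<integral>\<^sup>+ \<omega>. \<integral>\<^sup>+ s. G (s, \<omega>) * ?i s u \<partial>lborel \<partial>M) = (\<integral>\<^sup>+ s. \<Gamma> s * ?i s u \<partial>lborel)" .
  qed
  also have "\<dots> = (\<integral>\<^sup>+ s. \<integral>\<^sup>+ u. \<Gamma> s * ?i s u \<partial>distr M borel e \<partial>lborel)"
    by (rule EL.Fubini'[symmetric]) measurable
  also have "\<dots> = (\<integral>\<^sup>+ s. \<Gamma> s * (if 0 \<le> s then ennreal (exp (- s * q)) else 0) \<partial>lborel)"
    unfolding tail[symmetric] by (intro nn_integral_cong nn_integral_cmult) measurable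
  finally have "ennreal q * (\<integral>\<^sup>+ \<omega>. \<integral>\<^sup>+ s. G (s, \<omega>) * indicator {0..<e \<omega>} s \<partial>lborel \<partial>M)
      = (\<integral>\<^sup>+ s. ennreal q * (\<Gamma> s * (if 0 \<le> s then ennreal (exp (- s * q)) else 0)) \<partial>lborel)"
    by (simp add: nn_integral_cmult)
  also have "\<dots> = (\<integral>\<^sup>+ s. ennreal (exponential_density q s) * \<Gamma> s \<partial>lborel)"
    using \<open>0 < q\<close>
    by (intro nn_integral_cong) (auto simp: exponential_density_def ennreal_mult ac_simps)
  also have "\<dots> = (\<integral>\<^sup>+ s. \<Gamma> s \<partial>distr M borel e)"
    unfolding law by (rule nn_integral_density[symmetric]) measurable
  also have "\<dots> = (\<integral>\<^sup>+ \<omega>. G (e \<omega>, \<omega>) \<partial>M)"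
    unfolding \<Gamma>_def by (rule nn_integral_indep[OF e F indep G, symmetric])
  finally show ?thesis .
qed

end

section \<open>The density of the exponential functional\<close>

context prob_space
begin

text \<open>Off a null set the Lamperti path lies in the canonical space and agrees with its jointly measurable
version. On that space the indicator may be dropped, because \<open>1 / X t\<close> is 0 once \<open>X\<close> is absorbed.\<close>

lemma nn_integral_pssmp_law:
  assumes \<xi>: "\<And>t. 0 \<le> t \<Longrightarrow> \<xi> t \<in> borel_measurable M" and e: "e \<in> borel_measurable M"
    and good: "AE \<omega> in M. killed_path \<xi> e \<omega>" and "0 \<le> t"
  shows "(\<integral>\<^sup>+ X. ennreal (1 / X t) * indicator {X. ereal t < hit_zero X} X \<partial>pssmp_law M \<xi> e 1)
    = (\<integral>\<^sup>+ \<omega>. ennreal (1 / right_lamperti (\<lambda>u. \<xi> u \<omega>) (e \<omega>) t) \<partial>M)"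
proof -
  let ?C = "completion M"
  let ?P = "\<lambda>t \<omega>. if killed_path \<xi> e \<omega> then lamperti \<xi> e 1 t \<omega> else 0"
  \<comment> \<open>On the exceptional set the path is replaced by the one absorbed from the start.\<close>
  let ?L = "\<lambda>\<omega>. \<lambda>t\<in>{0..}. ?P t \<omega>"
  have goodC: "AE \<omega> in ?C. killed_path \<xi> e \<omega>"
    using good by (rule AE_completion)
  have coord: "?P t \<in> borel_measurable ?C" if "0 \<le> t" for t
  proof (rule measurable_completion_AE)
    show "(\<lambda>\<omega>. right_lamperti (\<lambda>u. \<xi> u \<omega>) (e \<omega>) t) \<in> borel_measurable M"
      using measurable_compose[OF measurable_Pair1' borel_measurable_right_lamperti_pair[OF \<xi> e], of t]
      by simp
    show "AE \<omega> in M. ?P t \<omega> = right_lamperti (\<lambda>u. \<xi> u \<omega>) (e \<omega>) t"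
      using good by eventually_elim (simp add: killed_path.right_lamperti_eq[OF _ that])
  qed simp
  have "?L \<in> measurable ?C (\<Pi>\<^sub>M t\<in>{0..}. borel)"
    by (intro measurable_restrict coord) simp
  moreover have "?L \<omega> \<in> space path_space" for \<omega>
  proof (cases "killed_path \<xi> e \<omega>")
    case True
    then show ?thesis
      using killed_path.lamperti_in_path_space[OF True] by simp
  next
    case False
    have "cadlag (\<lambda>t. 0)"
      by (auto simp: cadlag_def)
    from cadlag_restrict[OF this] False show ?thesis
      by (auto simp: path_space_def space_restrict_space space_PiM)
  qed
  ultimately have L: "?L \<in> measurable ?C path_space"
    unfolding path_space_def by (intro measurable_restrict_space2) (auto simp: space_restrict_space)
  have law: "pssmp_law M \<xi> e 1 = distr ?C path_space ?L"
    unfolding pssmp_law_def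
    by (rule distr_completion_AE[OF L]) (use goodC in \<open>eventually_elim, simp\<close>)
  have X: "(\<lambda>X. X t) \<in> borel_measurable path_space"
    unfolding path_space_def using \<open>0 \<le> t\<close>
    by (intro measurable_restrict_space1 measurable_component_singleton) simp
  have "(\<integral>\<^sup>+ X. ennreal (1 / X t) * indicator {X. ereal t < hit_zero X} X \<partial>pssmp_law M \<xi> e 1)
      = (\<integral>\<^sup>+ X. ennreal (1 / X t) \<partial>pssmp_law M \<xi> e 1)"
    by (intro nn_integral_cong)
       (auto simp: pssmp_law_def less_hit_zero_iff[OF _ \<open>0 \<le> t\<close>] indicator_def)
  also have "\<dots> = (\<integral>\<^sup>+ \<omega>. ennreal (1 / ?L \<omega> t) \<partial>?C)"
    unfolding law by (intro nn_integral_distr L) (use X in measurable)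
  also have "\<dots> = (\<integral>\<^sup>+ \<omega>. ennreal (1 / right_lamperti (\<lambda>u. \<xi> u \<omega>) (e \<omega>) t) \<partial>?C)"
    by (intro nn_integral_cong_AE, use goodC in eventually_elim)
       (use \<open>0 \<le> t\<close> in \<open>simp add: killed_path.right_lamperti_eq\<close>)
  finally show ?thesis
    by (simp add: nn_integral_completion)
qed

end

theorem theorem2p1:
  fixes M :: "'a measure" and \<xi> :: "real \<Rightarrow> 'a \<Rightarrow> real" and e :: "'a \<Rightarrow> real" and q :: real
  assumes "prob_space M"
    and "levy_process M \<xi>"
    and "q > 0"
    and "distributed M lborel e (exponential_density q)"
    and "indep_of_process M e \<xi>"
  shows "distributed (completion M) lborel (exp_functional \<xi> e)
           (\<lambda>t. if t \<ge> 0
                then ennreal q *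
                  (\<integral>\<^sup>+ X. ennreal (1 / X t) * indicator {X. ereal t < hit_zero X} X
                    \<partial>pssmp_law M \<xi> e 1)
                else 0)"
proof -
  interpret prob_space M by fact
  let ?C = "completion M"
  let ?R = "\<lambda>t \<omega>. ennreal (1 / right_lamperti (\<lambda>u. \<xi> u \<omega>) (e \<omega>) t)"
  let ?K = "\<lambda>s \<omega>. right_clock (\<lambda>u. \<xi> u \<omega>) s"
  let ?h = "\<lambda>t. if 0 \<le> t then ennreal q * (\<integral>\<^sup>+ \<omega>. ?R t \<omega> \<partial>M) else 0"
  have \<xi>: "\<xi> t \<in> borel_measurable M" if "0 \<le> t" for t
    using assms(2) that by (simp add: levy_process_def)
  have e[measurable]: "e \<in> borel_measurable M"
    using distributed_measurable[OF assms(4)] by simp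
  have "AE \<omega> in M. 0 < e \<omega>"
    using exponential_distributedD_gt[OF assms(4) order_refl assms(3)]
    by (subst prob_Collect_eq_1[symmetric]) auto
  moreover have "AE \<omega> in M. cadlag (\<lambda>t. \<xi> t \<omega>)"
    using assms(2) by (simp add: levy_process_def)
  ultimately have good: "AE \<omega> in M. killed_path \<xi> e \<omega>"
    by eventually_elim (simp add: killed_path_def)

  define F where "F = vimage_algebra (space M) (\<lambda>\<omega>. \<lambda>t\<in>{0..}. \<xi> t \<omega>) (\<Pi>\<^sub>M t\<in>{0..}. borel)"
  have indep: "indep_set (sets (vimage_algebra (space M) e borel)) (sets F)"
    using assms(5) by (simp add: indep_of_process_def F_def)
  have F: "sets F \<subseteq> events" "space F = space M"
    using indep_setD_ev2[OF indep] by (auto simp: F_def)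
  have \<xi>F: "\<xi> t \<in> borel_measurable F" if "0 \<le> t" for t
  proof -
    have "(\<lambda>\<omega>. \<lambda>t\<in>{0..}. \<xi> t \<omega>) \<in> measurable F (\<Pi>\<^sub>M t\<in>{0..}. borel)"
      unfolding F_def by (rule measurable_vimage_algebra1) (auto simp: space_PiM)
    from measurable_compose[OF this measurable_component_singleton[of t]] that
    show ?thesis by simp
  qed
  have KF: "(\<lambda>p. ?K (fst p) (snd p)) \<in> borel_measurable (borel \<Otimes>\<^sub>M F)"
    by (rule borel_measurable_right_clock_pair[OF \<xi>F])

  have K: "(\<lambda>\<omega>. ?K (e \<omega>) \<omega>) \<in> borel_measurable M"
    using measurable_compose[of "\<lambda>\<omega>. (e \<omega>, \<omega>)" M "borel \<Otimes>\<^sub>M M",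
        OF _ borel_measurable_right_clock_pair[OF \<xi>]] by simp
  have IK: "AE \<omega> in M. exp_functional \<xi> e \<omega> = ?K (e \<omega>) \<omega>"
    using good
    by eventually_elim (simp add: killed_path.exp_functional_eq_clock killed_path.right_clock_eq)
  have [measurable]: "(\<lambda>p. right_lamperti (\<lambda>u. \<xi> u (snd p)) (e (snd p)) (fst p)) \<in> borel_measurable (borel \<Otimes>\<^sub>M M)"
    by (rule borel_measurable_right_lamperti_pair[OF \<xi> e])
  have h[measurable]: "?h \<in> borel_measurable borel"
  proof -
    have [measurable]: "(\<lambda>t. \<integral>\<^sup>+ \<omega>. ?R t \<omega> \<partial>M) \<in> borel_measurable borel"
      by (rule borel_measurable_nn_integral) (simp add: case_prod_beta')
    show ?thesis by measurable
  qed
  interpret lborel_pair: pair_sigma_finite M lborel ..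

  \<comment> \<open>By Tonelli, \<open>h\<close> is integrated over \<open>B\<close> path by path; there it becomes an integral over the
    time before killing, which the exponential horizon turns into evaluation at the killing time.\<close>
  have main: "emeasure (density lborel ?h) B = emeasure (distr M lborel (\<lambda>\<omega>. ?K (e \<omega>) \<omega>)) B"
    if [measurable]: "B \<in> sets borel" for B
  proof -
    have "emeasure (density lborel ?h) B = (\<integral>\<^sup>+ t. ?h t * indicator B t \<partial>lborel)"
      by (rule emeasure_density) auto
    also have "\<dots> = (\<integral>\<^sup>+ t. ennreal q * (\<integral>\<^sup>+ \<omega>. ?R t \<omega> * (indicator B t * indicator {0..} t) \<partial>M) \<partial>lborel)"
    proof (rule nn_integral_cong)
      fix t :: real
      have "?R t \<in> borel_measurable M"
        using measurable_compose[OF measurable_Pair1' borel_measurable_right_lamperti_pair[OF \<xi> e], of t]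
        by simp
      then show "?h t * indicator B t
          = ennreal q * (\<integral>\<^sup>+ \<omega>. ?R t \<omega> * (indicator B t * indicator {0..} t) \<partial>M)"
        by (subst nn_integral_multc) (auto simp: indicator_def)
    qed
    also have "\<dots> = ennreal q * (\<integral>\<^sup>+ t. \<integral>\<^sup>+ \<omega>. ?R t \<omega> * (indicator B t * indicator {0..} t) \<partial>M \<partial>lborel)"
      by (rule nn_integral_cmult) measurable
    also have "(\<integral>\<^sup>+ t. \<integral>\<^sup>+ \<omega>. ?R t \<omega> * (indicator B t * indicator {0..} t) \<partial>M \<partial>lborel)
        = (\<integral>\<^sup>+ \<omega>. \<integral>\<^sup>+ t. ?R t \<omega> * (indicator B t * indicator {0..} t) \<partial>lborel \<partial>M)"
    proof (rule lborel_pair.Fubini')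
      have [measurable]: "(\<lambda>x. right_lamperti (\<lambda>u. \<xi> u (fst x)) (e (fst x)) (snd x))
          \<in> borel_measurable (M \<Otimes>\<^sub>M lborel)"
        using measurable_compose[of "\<lambda>x. (snd x, fst x)" "M \<Otimes>\<^sub>M lborel" "borel \<Otimes>\<^sub>M M",
            OF _ borel_measurable_right_lamperti_pair[OF \<xi> e]] by simp
      have "(\<lambda>t. indicator B t * indicator {0..} t :: ennreal) \<in> borel_measurable lborel"
        by simp
      from measurable_compose[OF measurable_snd this]
      have [measurable]: "(\<lambda>x. indicator B (snd x) * indicator {0..} (snd x) :: ennreal)
          \<in> borel_measurable (M \<Otimes>\<^sub>M lborel)" .
      show "(\<lambda>(\<omega>, t). ?R t \<omega> * (indicator B t * indicator {0..} t))
          \<in> borel_measurable (M \<Otimes>\<^sub>M lborel)"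
        by (simp add: case_prod_beta')
    qed
    also have "\<dots> = (\<integral>\<^sup>+ \<omega>. \<integral>\<^sup>+ s. indicator B (?K s \<omega>) * indicator {0..<e \<omega>} s \<partial>lborel \<partial>M)"
    proof (rule nn_integral_cong_AE, use good in eventually_elim)
      fix \<omega> assume "killed_path \<xi> e \<omega>"
      then interpret killed_path \<xi> e \<omega> .
      have "(\<integral>\<^sup>+ t. ?R t \<omega> * (indicator B t * indicator {0..} t) \<partial>lborel)
          = (\<integral>\<^sup>+ t. ennreal (1 / lamperti \<xi> e 1 t \<omega>) * indicator B t * indicator {0..} t \<partial>lborel)"
        by (intro nn_integral_cong) (auto simp: indicator_def right_lamperti_eq)
      also have "\<dots> = (\<integral>\<^sup>+ s. indicator B (?K s \<omega>) * indicator {0..<e \<omega>} s \<partial>lborel)"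
        unfolding right_clock_eq by (rule nn_integral_inverse_lamperti) measurable
      finally show "(\<integral>\<^sup>+ t. ?R t \<omega> * (indicator B t * indicator {0..} t) \<partial>lborel)
          = (\<integral>\<^sup>+ s. indicator B (?K s \<omega>) * indicator {0..<e \<omega>} s \<partial>lborel)" .
    qed
    also have "ennreal q * \<dots> = (\<integral>\<^sup>+ \<omega>. indicator B (?K (e \<omega>) \<omega>) \<partial>M)"
    proof -
      have "(\<lambda>p. indicator B (?K (fst p) (snd p)) :: ennreal) \<in> borel_measurable (borel \<Otimes>\<^sub>M F)"
        by (rule measurable_compose[OF KF]) simp
      from nn_integral_exponential_horizon[OF assms(4,3) F indep this] show ?thesis by simp
    qed
    also have "\<dots> = (\<integral>\<^sup>+ x. indicator B x \<partial>distr M lborel (\<lambda>\<omega>. ?K (e \<omega>) \<omega>))"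
      using K by (subst nn_integral_distr) auto
    also have "\<dots> = emeasure (distr M lborel (\<lambda>\<omega>. ?K (e \<omega>) \<omega>)) B"
      by simp
    finally show ?thesis .
  qed

  have "distr ?C lborel (exp_functional \<xi> e) = distr ?C lborel (\<lambda>\<omega>. ?K (e \<omega>) \<omega>)"
    by (rule distr_completion_AE[OF measurable_completion]) (use K AE_completion[OF IK] in auto)
  also have "\<dots> = distr M lborel (\<lambda>\<omega>. ?K (e \<omega>) \<omega>)"
    using K by (intro distr_completion) simp
  also have "\<dots> = density lborel ?h"
    by (rule measure_eqI) (simp_all add: main)
  finally have "distr ?C lborel (exp_functional \<xi> e) = density lborel ?h" .
  moreover have "exp_functional \<xi> e \<in> measurable ?C lborel"
    by (rule measurable_completion_AE[OF _ _ IK]) (use K in auto)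
  ultimately have "distributed ?C lborel (exp_functional \<xi> e) ?h"
    using h by (simp add: distributed_def)
  also have "?h = (\<lambda>t. if t \<ge> 0
                then ennreal q *
                  (\<integral>\<^sup>+ X. ennreal (1 / X t) * indicator {X. ereal t < hit_zero X} X
                    \<partial>pssmp_law M \<xi> e 1)
                else 0)"
    by (auto simp: nn_integral_pssmp_law[OF \<xi> e good])
  finally show ?thesis .
qed

end
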